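(* Let $p$ and $q$ be positive integers with $p \neq q$, $\gcd(p,q) = 1$ and $p + q$ odd. For each positive integer $n$, let $m(n)$ denote the greatest integer $m \ge 1$ such that the grid graph $\square_m$ embeds into the leaper graph $\mathcal{L}_n$ of the $(p,q)$-leaper. Then there is a constant $C$, depending only on $p$ and $q$ (and not on $n$), such that $|m(n) - n| \le C$ for all positive integers $n$; i.e., $m(n) = n + O_{p,q}(1)$.
   Context: Let $[n] = \{1, 2, \ldots, n\}$. The grid graph $\square_n$ has vertex set $[n]^2$, with $(x', y')$ and $(x'', y'')$ adjacent iff they are at Euclidean distance $1$. For positive integers $p \ne q$, the $(p,q)$-leaper graph $\mathcal{L}_n$ has vertex set $[n]^2$, with $(x', y')$ and $(x'', y'')$ adjacent iff $\{|x' - x''|, |y' - y''|\} = \{p, q\}$. A graph $G$ embeds into a graph $H$ if $G$ is isomorphic to a (not necessarily induced) subgraph of $H$. *)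

theory Defs
  imports "HOL-Analysis.Product_Vector"
begin

text \<open>An undirected graph is a pair of a vertex set and a set of edges, each edge being an
  unordered pair of distinct vertices.\<close>

type_synonym 'a ugraph = "'a set \<times> 'a set set"

abbreviation verts :: "'a ugraph \<Rightarrow> 'a set" where "verts \<equiv> fst"
abbreviation edges :: "'a ugraph \<Rightarrow> 'a set set" where "edges \<equiv> snd"

definition is_graph :: "'a ugraph \<Rightarrow> bool" where
  "is_graph G \<longleftrightarrow> (\<forall>e\<in>edges G. e \<subseteq> verts G \<and> card e = 2)"

definition subgraph :: "'a ugraph \<Rightarrow> 'a ugraph \<Rightarrow> bool" where
  "subgraph K H \<longleftrightarrow> is_graph K \<and> verts K \<subseteq> verts H \<and> edges K \<subseteq> edges H"

definition isomorphic :: "'a ugraph \<Rightarrow> 'b ugraph \<Rightarrow> bool" where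
  "isomorphic G H \<longleftrightarrow>
    (\<exists>f. bij_betw f (verts G) (verts H) \<and>
         (\<forall>u\<in>verts G. \<forall>v\<in>verts G. {u, v} \<in> edges G \<longleftrightarrow> {f u, f v} \<in> edges H))"

definition embeds :: "'a ugraph \<Rightarrow> 'b ugraph \<Rightarrow> bool" where
  "embeds G H \<longleftrightarrow> (\<exists>K. subgraph K H \<and> isomorphic G K)"

definition graph_of :: "'a set \<Rightarrow> ('a \<Rightarrow> 'a \<Rightarrow> bool) \<Rightarrow> 'a ugraph" where
  "graph_of V adj = (V, {{u, v} | u v. u \<in> V \<and> v \<in> V \<and> adj u v})"

definition board :: "nat \<Rightarrow> (int \<times> int) set" where
  "board n = {1..int n} \<times> {1..int n}"

text \<open>The metric on \<^typ>\<open>real \<times> real\<close> is the Euclidean one.\<close>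

definition grid_adj :: "int \<times> int \<Rightarrow> int \<times> int \<Rightarrow> bool" where
  "grid_adj = (\<lambda>(x', y') (x'', y'').
    dist (real_of_int x', real_of_int y') (real_of_int x'', real_of_int y'') = 1)"

definition leaper_adj :: "nat \<Rightarrow> nat \<Rightarrow> int \<times> int \<Rightarrow> int \<times> int \<Rightarrow> bool" where
  "leaper_adj p q = (\<lambda>(x', y') (x'', y''). {\<bar>x' - x''\<bar>, \<bar>y' - y''\<bar>} = {int p, int q})"

definition grid :: "nat \<Rightarrow> (int \<times> int) ugraph" where
  "grid n = graph_of (board n) grid_adj"

definition leaper :: "nat \<Rightarrow> nat \<Rightarrow> nat \<Rightarrow> (int \<times> int) ugraph" where
  "leaper p q n = graph_of (board n) (leaper_adj p q)"

definition max_grid :: "nat \<Rightarrow> nat \<Rightarrow> nat \<Rightarrow> nat" where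
  "max_grid p q n = (GREATEST m. 1 \<le> m \<and> embeds (grid m) (leaper p q n))"

lemma is_graph_grid: "is_graph (grid n)"
  by (fastforce simp: is_graph_def grid_def graph_of_def grid_adj_def card_2_iff)

lemma is_graph_leaper: "0 < p \<Longrightarrow> 0 < q \<Longrightarrow> is_graph (leaper p q n)"
  by (fastforce simp: is_graph_def leaper_def graph_of_def leaper_adj_def card_2_iff)

lemma card_board: "card (board n) = n * n"
  by (simp add: board_def card_cartesian_product)

lemma embeds_grid_leaper_le:
  assumes "embeds (grid m) (leaper p q n)"
  shows "m \<le> n"
proof -
  obtain K f where K: "verts K \<subseteq> board n" and f: "bij_betw f (board m) (verts K)"
    using assms
    by (auto simp: embeds_def subgraph_def isomorphic_def grid_def leaper_def graph_of_def)
  have "card (board m) \<le> card (board n)"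
    using bij_betw_same_card[OF f] card_mono[OF _ K] by (simp add: board_def)
  then have "m\<^sup>2 \<le> n\<^sup>2"
    by (simp add: card_board power2_eq_square)
  then show ?thesis
    by simp
qed

lemma embeds_grid_1:
  assumes "1 \<le> n"
  shows "embeds (grid 1) (leaper p q n)"
proof -
  have b: "board 1 = {(1, 1)}"
    by (auto simp: board_def)
  have g: "grid 1 = ({(1, 1)}, {})"
    unfolding grid_def graph_of_def b by (auto simp: grid_adj_def)
  have "subgraph ({(1, 1)}, {}) (leaper p q n)"
    using assms by (auto simp: subgraph_def is_graph_def leaper_def graph_of_def board_def)
  moreover have "isomorphic (grid 1) (grid 1)"
    unfolding isomorphic_def by (intro exI[of _ id]) auto
  ultimately show ?thesis
    unfolding embeds_def g by blast
qed

text \<open>The greatest value exists, so \<^const>\<open>max_grid\<close> is meaningful.\<close>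

lemma max_grid:
  assumes "1 \<le> n"
  shows "1 \<le> max_grid p q n" "embeds (grid (max_grid p q n)) (leaper p q n)"
    and "embeds (grid m) (leaper p q n) \<Longrightarrow> m \<le> max_grid p q n"
proof -
  let ?P = "\<lambda>m. 1 \<le> m \<and> embeds (grid m) (leaper p q n)"
  have P1: "?P 1" and bd: "\<And>m. ?P m \<Longrightarrow> m \<le> n"
    using embeds_grid_1[OF assms] embeds_grid_leaper_le by auto
  have "?P (max_grid p q n)"
    unfolding max_grid_def using P1 bd by (rule GreatestI_nat)
  then show "1 \<le> max_grid p q n" "embeds (grid (max_grid p q n)) (leaper p q n)"
    by auto
  have "?P m \<Longrightarrow> m \<le> max_grid p q n" for m
    unfolding max_grid_def using bd by (intro Greatest_le_nat[of ?P m n])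
  then show "embeds (grid m) (leaper p q n) \<Longrightarrow> m \<le> max_grid p q n"
    by (cases "1 \<le> m") auto
qed

end

theory Submission
  imports Defs
begin

text \<open>By symmetry let \<open>p\<close> be odd and \<open>q\<close> even. Take a walk \<open>(a, b)\<close> in the integer plane that
  moves diagonally, so both coordinates change by \<open>\<plusminus>1\<close> in every step, and map \<open>(x, y)\<close> to
  \<open>(p * a x + q * b y, q * b x + p * a y)\<close>. Grid edges then become leaper moves. The walk sweeps two
  adjacent columns at a time, alternately upwards and downwards, in a horizontal strip of
  \<open>2 * p + 1\<close> rows; it spends \<open>2 * p\<close> steps on each pair of columns, so \<open>p * a x = x + O(1)\<close> while
  \<open>b\<close> is bounded, and the image of each point is within a bounded distance of that point.

  If two points have the same image, then coprimality of \<open>p\<close> and \<open>q\<close> makes the differences of the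
  values of \<open>a\<close> multiples of \<open>q\<close>, and those of \<open>b\<close> multiples of \<open>p\<close>. As \<open>a + b\<close> is always even, the
  latter are in fact multiples of \<open>2 * p\<close>. The strip is so narrow that a nonzero such multiple
  only occurs between the top of an upward sweep and the bottom of a downward one; but there the
  values of \<open>a\<close> differ by \<open>2\<close> modulo \<open>4\<close>, whereas here they differ by a multiple of \<open>2 * q\<close>.\<close>

section \<open>Embeddings and grid edges\<close>

lemma embedsI:
  assumes G: "is_graph G" and inj: "inj_on f (verts G)" and vs: "f ` verts G \<subseteq> verts H"
    and es: "\<And>e. e \<in> edges G \<Longrightarrow> f ` e \<in> edges H"
  shows "embeds G H"
proof -
  \<comment> \<open>Only images of edges of \<open>G\<close> are kept, not all edges of
    \<open>H\<close> between image vertices, so that \<open>f\<close> also reflects edges.\<close>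
  let ?K = "(f ` verts G, (`) f ` edges G)"
  have sub: "e \<subseteq> verts G" if "e \<in> edges G" for e
    using G that by (auto simp: is_graph_def)
  have "card (f ` e) = 2" if "e \<in> edges G" for e
    using G that card_image[OF inj_on_subset[OF inj sub[OF that]]] by (auto simp: is_graph_def)
  moreover have "f ` e \<subseteq> f ` verts G" if "e \<in> edges G" for e
    using sub[OF that] by (rule image_mono)
  ultimately have "subgraph ?K H"
    using vs es by (simp add: subgraph_def is_graph_def image_subset_iff)
  moreover have "{u, v} \<in> edges G \<longleftrightarrow> {f u, f v} \<in> edges ?K" if "u \<in> verts G" "v \<in> verts G" for u v
  proof
    assume "{u, v} \<in> edges G"
    then have "f ` {u, v} \<in> edges ?K"
      unfolding snd_conv by (rule imageI)
    then show "{f u, f v} \<in> edges ?K"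
      by simp
  next
    assume "{f u, f v} \<in> edges ?K"
    then obtain e where e: "e \<in> edges G" "f ` {u, v} = f ` e"
      by auto
    then have "{u, v} = e"
      using inj_on_image_eq_iff[OF inj, of "{u, v}" e] that sub by simp
    with e show "{u, v} \<in> edges G"
      by simp
  qed
  then have "isomorphic G ?K"
    unfolding isomorphic_def using inj_on_imp_bij_betw[OF inj] by (intro exI[of _ f]) simp
  ultimately show ?thesis
    unfolding embeds_def by blast
qed

text \<open>Each edge is read as a step to the right or upwards, so that a walk need only be
  examined from \<open>z\<close> to \<open>z + 1\<close>.\<close>

lemma grid_adjE:
  assumes "grid_adj u v"
  obtains x y where "u = (x, y)" "v = (x + 1, y)" | x y where "v = (x, y)" "u = (x + 1, y)"
    | x y where "u = (x, y)" "v = (x, y + 1)" | x y where "v = (x, y)" "u = (x, y + 1)"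
proof -
  obtain x y x' y' where uv: "u = (x, y)" "v = (x', y')"
    by (metis surj_pair)
  have "(real_of_int x - real_of_int x')\<^sup>2 + (real_of_int y - real_of_int y')\<^sup>2 = 1"
    using assms by (simp add: uv grid_adj_def dist_prod_def dist_real_def)
  then have "real_of_int ((x - x')\<^sup>2 + (y - y')\<^sup>2) = real_of_int 1"
    by simp
  then have eq: "(x - x')\<^sup>2 + (y - y')\<^sup>2 = 1"
    by (simp only: of_int_eq_iff)
  then have "(x - x')\<^sup>2 \<le> 1" "(y - y')\<^sup>2 \<le> 1"
    using zero_le_power2[of "x - x'"] zero_le_power2[of "y - y'"] by linarith+
  then have "\<bar>x - x'\<bar> \<le> 1" "\<bar>y - y'\<bar> \<le> 1"
    by (simp_all only: abs_square_le_1)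
  then have "x - x' \<in> {-1, 0, 1}" "y - y' \<in> {-1, 0, 1}"
    by auto
  with eq have "(x' = x + 1 \<and> y' = y) \<or> (x = x' + 1 \<and> y' = y) \<or>
      (x' = x \<and> y' = y + 1) \<or> (x' = x \<and> y = y' + 1)"
    by auto
  then show thesis
    using that uv by blast
qed

lemma leaper_adj_commute: "leaper_adj p q u v \<longleftrightarrow> leaper_adj p q v u"
  by (cases u; cases v) (simp add: leaper_adj_def abs_minus_commute)

section \<open>The zigzag walk\<close>

definition zigzag_col :: "int \<Rightarrow> int \<Rightarrow> int" where
  "zigzag_col p x = 2 * (x div (2 * p)) + x mod 2"

text \<open>The offset \<open>2 * p - 2\<close> makes the turns diagonal: a downward sweep starts
  one row below the top \<open>2 * p - 1\<close> of the upward sweep and ends at row -1, one row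
  below the start of the next.\<close>

definition zigzag_row :: "int \<Rightarrow> int \<Rightarrow> int" where
  "zigzag_row p x =
    (if even (x div (2 * p)) then x mod (2 * p) else 2 * p - 2 - x mod (2 * p))"

lemma div_mod_succ_cases:
  fixes x d :: int
  assumes "0 < d"
  obtains "(x + 1) div d = x div d" "(x + 1) mod d = x mod d + 1"
    | "(x + 1) div d = x div d + 1" "(x + 1) mod d = 0" "x mod d = d - 1"
proof (cases "x mod d = d - 1")
  case True
  then have "x + 1 = d * (x div d + 1)"
    using mult_div_mod_eq[of d x] unfolding distrib_left by linarith
  then show thesis
    using that(2) True assms by simp
next
  case False
  then have "0 \<le> x mod d + 1" "x mod d + 1 < d"
    using pos_mod_bound[OF assms, of x] pos_mod_sign[OF assms, of x] by linarith+
  moreover have "x + 1 = d * (x div d) + (x mod d + 1)"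
    using mult_div_mod_eq[of d x] by simp
  ultimately show thesis
    using that(1) int_div_pos_eq int_mod_pos_eq by blast
qed

context
  fixes p :: int
  assumes p: "0 < p"
begin

lemma mod_2p_bounds: "0 \<le> x mod (2 * p)" "x mod (2 * p) < 2 * p"
  using p by simp_all

lemma even_mod_2p: "even (x mod (2 * p)) \<longleftrightarrow> even x"
  by (simp add: dvd_mod_iff)

lemma zigzag_step:
  "\<bar>zigzag_col p (x + 1) - zigzag_col p x\<bar> = 1" "\<bar>zigzag_row p (x + 1) - zigzag_row p x\<bar> = 1"
proof -
  have x2: "x mod 2 = (if even x then 0 else 1)" "(x + 1) mod 2 = (if even x then 1 else 0)"
    by presburger+
  have "0 < 2 * p"
    using p by simp
  then have "\<bar>zigzag_col p (x + 1) - zigzag_col p x\<bar> = 1 \<and> \<bar>zigzag_row p (x + 1) - zigzag_row p x\<bar> = 1"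
  proof (cases rule: div_mod_succ_cases[of "2 * p" x])
    case 1
    then show ?thesis
      by (simp add: zigzag_col_def zigzag_row_def x2)
  next
    case 2
    \<comment> \<open>A sweep ends at odd \<open>x\<close>, in the right-hand column of its pair, so
      the turn leads to the left-hand column of the next pair.\<close>
    then have "odd x"
      using even_mod_2p[of x] by simp
    with 2 show ?thesis
      by (simp add: zigzag_col_def zigzag_row_def x2)
  qed
  then show "\<bar>zigzag_col p (x + 1) - zigzag_col p x\<bar> = 1" "\<bar>zigzag_row p (x + 1) - zigzag_row p x\<bar> = 1"
    by auto
qed

lemma even_zigzag: "even (zigzag_col p x + zigzag_row p x)"
  using even_mod_2p[of x] by (simp add: zigzag_col_def zigzag_row_def)

lemma zigzag_row_bounds: "-1 \<le> zigzag_row p x" "zigzag_row p x \<le> 2 * p - 1"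
  using mod_2p_bounds[of x] by (auto simp: zigzag_row_def)

lemma zigzag_col_bounds: "x - 2 * p \<le> p * zigzag_col p x" "p * zigzag_col p x \<le> x + p"
proof -
  have "p * zigzag_col p x = x - x mod (2 * p) + p * (x mod 2)"
    using mult_div_mod_eq[of "2 * p" x] by (simp add: zigzag_col_def algebra_simps)
  moreover have "0 \<le> p * (x mod 2)" "p * (x mod 2) \<le> p"
    using p by (simp_all add: mult_le_cancel_left1)
  ultimately show "x - 2 * p \<le> p * zigzag_col p x" "p * zigzag_col p x \<le> x + p"
    using mod_2p_bounds[of x] by linarith+
qed

text \<open>Halving the column recovers the number of the sweep, and no row repeats within a
  sweep.\<close>

lemma zigzag_inject:
  assumes "zigzag_col p x = zigzag_col p y" "zigzag_row p x = zigzag_row p y"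
  shows "x = y"
proof -
  have d: "x div (2 * p) = y div (2 * p)"
    using arg_cong[OF assms(1), of "\<lambda>z. z div 2"] by (simp add: zigzag_col_def)
  moreover have "x mod (2 * p) = y mod (2 * p)"
    using assms(2) d by (auto simp: zigzag_row_def split: if_splits)
  ultimately show ?thesis
    by (metis mult_div_mod_eq)
qed

text \<open>Both rows must be extreme: the top occurs only at the end of an upward sweep, row -1
  only at the end of a downward one. Both times are then odd, so the columns differ by twice the odd
  difference of the sweep numbers.\<close>

lemma zigzag_row_diff_2p:
  assumes "zigzag_row p x - zigzag_row p y = 2 * p"
  shows "\<not> 4 dvd zigzag_col p x - zigzag_col p y"
proof -
  have r: "zigzag_row p x = 2 * p - 1" "zigzag_row p y = -1"
    using assms zigzag_row_bounds[of x] zigzag_row_bounds[of y] by linarith+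
  have "even (x div (2 * p))" "x mod (2 * p) = 2 * p - 1"
    using r(1) mod_2p_bounds[of x] by (auto simp: zigzag_row_def split: if_splits)
  moreover have "odd (y div (2 * p))" "y mod (2 * p) = 2 * p - 1"
    using r(2) mod_2p_bounds[of y] by (auto simp: zigzag_row_def split: if_splits)
  moreover have "odd x" "odd y"
    using calculation even_mod_2p[of x] even_mod_2p[of y] by simp_all
  ultimately have "zigzag_col p x - zigzag_col p y = 2 * (x div (2 * p) - y div (2 * p))"
    "odd (x div (2 * p) - y div (2 * p))"
    by (simp_all add: zigzag_col_def odd_iff_mod_2_eq_one)
  then show ?thesis
    using dvd_mult_cancel_left[of 2 2 "x div (2 * p) - y div (2 * p)"] by simp
qed

lemma zigzag_row_eqI:
  assumes "zigzag_row p x - zigzag_row p y = p * l" "even l" "4 dvd zigzag_col p x - zigzag_col p y"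
  shows "zigzag_row p x = zigzag_row p y"
proof -
  have "\<bar>p * l\<bar> \<le> p * 2"
    using assms(1) zigzag_row_bounds[of x] zigzag_row_bounds[of y] by linarith
  then have "\<bar>l\<bar> \<le> 2"
    using p by (simp add: abs_mult)
  then have "l = 0 \<or> l = 2 \<or> l = -2"
    using \<open>even l\<close> by presburger
  moreover have "l \<noteq> 2"
    using zigzag_row_diff_2p[of x y] assms by auto
  moreover have "l \<noteq> -2"
    using zigzag_row_diff_2p[of y x] assms by (auto simp: dvd_diff_commute)
  ultimately show ?thesis
    using assms(1) by auto
qed

end

section \<open>Two walks combined into one injective map\<close>

definition zigzag_map :: "int \<Rightarrow> int \<Rightarrow> int \<times> int \<Rightarrow> int \<times> int" where
  "zigzag_map p q = (\<lambda>(x, y).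
    (p * zigzag_col p x + q * zigzag_row p y, q * zigzag_row p x + p * zigzag_col p y))"

lemma coprime_lin_eqE:
  fixes p q s t :: int
  assumes "p * s + q * t = 0" "coprime p q" "p \<noteq> 0"
  obtains k where "s = q * k" "t = p * (-k)"
proof -
  have "p dvd q * t"
    using assms(1) dvd_add_right_iff[of p "p * s" "q * t"] by simp
  then have "p dvd t"
    using assms(2) by (simp add: coprime_dvd_mult_right_iff)
  then obtain k where k: "t = p * k" ..
  then have "p * (s + q * k) = 0"
    using assms(1) by (simp add: algebra_simps)
  then have "s = q * (-k)"
    using assms(3) by simp
  then show thesis
    using that[of "-k"] k by simp
qed

lemma inj_zigzag_map:
  assumes p: "0 < p" "odd p" and q: "even q" and cop: "coprime p q"
  shows "inj (zigzag_map p q)"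
proof (rule injI, clarify)
  fix x y x' y'
  assume eq: "zigzag_map p q (x, y) = zigzag_map p q (x', y')"
  let ?a = "zigzag_col p" and ?b = "zigzag_row p"
  have "p * (?a x - ?a x') + q * (?b y - ?b y') = 0"
    using eq by (simp add: zigzag_map_def algebra_simps)
  then obtain k where k: "?a x - ?a x' = q * k" "?b y - ?b y' = p * (-k)"
    using coprime_lin_eqE cop p(1) by (metis less_irrefl)
  have "p * (?a y - ?a y') + q * (?b x - ?b x') = 0"
    using eq by (simp add: zigzag_map_def algebra_simps)
  then obtain l where l: "?a y - ?a y' = q * l" "?b x - ?b x' = p * (-l)"
    using coprime_lin_eqE cop p(1) by (metis less_irrefl)
  have par: "even ((?a z - ?a z') + (?b z - ?b z'))" for z z'
    using even_zigzag[OF p(1), of z] even_zigzag[OF p(1), of z'] by presburger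
  \<comment> \<open>Parity along the walk in \<open>y\<close> makes \<open>q * l - p * k\<close>
    even, hence \<open>k\<close> even, as \<open>p\<close> is odd and \<open>q\<close> even; the
    walk in \<open>x\<close> gives \<open>l\<close> likewise.\<close>
  have ev: "even k" "even l"
    using par[of y y'] par[of x x'] p(2) q unfolding k l by auto
  then have "4 dvd q * k" "4 dvd q * l"
    using q mult_dvd_mono[of 2 q 2] by fastforce+
  then have b: "?b x = ?b x'" "?b y = ?b y'"
    using zigzag_row_eqI[OF p(1)] k l ev by (metis even_minus)+
  then have "k = 0" "l = 0"
    using k(2) l(2) p(1) by auto
  then have "?a x = ?a x'" "?a y = ?a y'"
    using k(1) l(1) by auto
  with b show "x = x' \<and> y = y'"
    using zigzag_inject[OF p(1)] by blast
qed

lemma leaper_adj_zigzag_map: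
  assumes "0 < p"
  shows "leaper_adj p q (zigzag_map p q (x, y)) (zigzag_map p q (x + 1, y))"
    and "leaper_adj p q (zigzag_map p q (x, y)) (zigzag_map p q (x, y + 1))"
proof -
  have "\<bar>c * zigzag_col p z - c * zigzag_col p (z + 1)\<bar> = \<bar>c\<bar>"
    "\<bar>c * zigzag_row p z - c * zigzag_row p (z + 1)\<bar> = \<bar>c\<bar>" for c z
    using zigzag_step[of "int p" z] assms
    by (simp_all add: abs_mult abs_minus_commute flip: right_diff_distrib)
  then show "leaper_adj p q (zigzag_map p q (x, y)) (zigzag_map p q (x + 1, y))"
    "leaper_adj p q (zigzag_map p q (x, y)) (zigzag_map p q (x, y + 1))"
    by (simp_all add: leaper_adj_def zigzag_map_def insert_commute)
qed

lemma leaper_adj_translate: "leaper_adj p q (u + w) (v + w) \<longleftrightarrow> leaper_adj p q u v"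
  by (cases u; cases v; cases w) (simp add: leaper_adj_def)

lemma grid_embeds_leaper:
  assumes p: "0 < p" "odd p" and q: "even q" and cop: "coprime p q"
  shows "embeds (grid m) (leaper p q (m + (3 * p + 2 * p * q)))"
proof -
  \<comment> \<open>The image falls short of the point by at most \<open>2 * p + q\<close> in each
    coordinate and exceeds it by at most \<open>p + q * (2 * p - 1)\<close>; the sum of both is the
    extra side length.\<close>
  define w :: "int \<times> int" where "w = (2 * p + q, 2 * p + q)"
  define f where "f u = zigzag_map p q u + w" for u
  have p0: "0 < int p"
    using p by simp
  have bounds: "1 \<le> p * zigzag_col p x + q * zigzag_row p y + (2 * p + q)"
    "p * zigzag_col p x + q * zigzag_row p y + (2 * p + q) \<le> m + (3 * p + 2 * p * q)"
    if "1 \<le> x" "x \<le> m" for x y :: int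
  proof -
    have "int q * (-1) \<le> q * zigzag_row p y" "q * zigzag_row p y \<le> int q * (2 * int p - 1)"
      using zigzag_row_bounds[OF p0, of y] by (intro mult_left_mono; simp)+
    then show "1 \<le> p * zigzag_col p x + q * zigzag_row p y + (2 * p + q)"
      "p * zigzag_col p x + q * zigzag_row p y + (2 * p + q) \<le> m + (3 * p + 2 * p * q)"
      using zigzag_col_bounds[OF p0, of x] that by (simp_all add: algebra_simps)
  qed
  have vs: "f ` board m \<subseteq> board (m + (3 * p + 2 * p * q))"
    using bounds by (auto simp: f_def w_def board_def zigzag_map_def add_ac)
  have adj: "leaper_adj p q (f u) (f v)" if "grid_adj u v" for u v
    using that leaper_adj_zigzag_map[OF p(1)] leaper_adj_commute
    unfolding f_def leaper_adj_translate by (cases rule: grid_adjE) blast+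
  have "inj f"
    using inj_zigzag_map[of p q] assms by (simp add: f_def inj_def)
  then have "inj_on f (board m)"
    by (rule inj_on_subset) simp
  then show ?thesis
  proof (intro embedsI[of _ f] is_graph_grid)
    fix e
    assume "e \<in> edges (grid m)"
    then obtain u v where "e = {u, v}" "u \<in> board m" "v \<in> board m" "grid_adj u v"
      by (auto simp: grid_def graph_of_def)
    then have "f ` e = {f u, f v}" "f u \<in> board (m + (3 * p + 2 * p * q))"
      "f v \<in> board (m + (3 * p + 2 * p * q))" "leaper_adj p q (f u) (f v)"
      using vs adj by auto
    then show "f ` e \<in> edges (leaper p q (m + (3 * p + 2 * p * q)))"
      unfolding leaper_def graph_of_def snd_conv by blast
  qed (use vs in \<open>auto simp: grid_def leaper_def graph_of_def\<close>)
qed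

lemma leaper_commute: "leaper p q n = leaper q p n"
  by (simp add: leaper_def leaper_adj_def insert_commute)

theorem theorem1:
  fixes p q :: nat
  assumes "0 < p" and "0 < q" and "p \<noteq> q" and "gcd p q = 1" and "odd (p + q)"
  shows "\<exists>C::real. \<forall>n::nat. 1 \<le> n \<longrightarrow> \<bar>real (max_grid p q n) - real n\<bar> \<le> C"
proof -
  obtain C where C: "embeds (grid m) (leaper p q (m + C))" for m
  proof (cases "odd p")
    case True
    with assms show thesis
      by (intro that[of "3 * p + 2 * p * q"] grid_embeds_leaper) (auto simp: coprime_iff_gcd_eq_1)
  next
    case False
    with assms show thesis
      by (intro that[of "3 * q + 2 * q * p"], subst leaper_commute, intro grid_embeds_leaper)
        (auto simp: coprime_iff_gcd_eq_1 gcd.commute)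
  qed
  have "\<bar>real (max_grid p q n) - real n\<bar> \<le> C" if n: "1 \<le> n" for n
  proof -
    have "max_grid p q n \<le> n"
      using max_grid(2)[OF n] by (rule embeds_grid_leaper_le)
    \<comment> \<open>For \<open>C \<le> n\<close> the grid of side \<open>n - C\<close> embeds; for
      smaller \<open>n\<close> the bound is trivial.\<close>
    moreover have "n \<le> max_grid p q n + C"
    proof (cases "C \<le> n")
      case True
      then show ?thesis
        using max_grid(3)[OF n, of "n - C" p q] C[of "n - C"] by simp
    qed simp
    ultimately show ?thesis
      by linarith
  qed
  then show ?thesis
    by blast
qed

end
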